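(* Let $\mathbf{f}\in C_c^\infty(S^2;\mathbb{D})$ be a symmetric $2$-tensor field. Then $\mathbf{f}$ can be recovered from the knowledge of its longitudinal, transverse and mixed Gaussian beam Radon transforms $\mathcal{L}\mathbf{f}$, $\mathcal{T}\mathbf{f}$ and $\mathcal{M}\mathbf{f}$. That is, $\mathbf{f}$ is uniquely determined by this data: if $\mathbf{f},\mathbf{h}\in C_c^\infty(S^2;\mathbb{D})$ satisfy $\mathcal{L}\mathbf{f}(s,\theta)=\mathcal{L}\mathbf{h}(s,\theta)$, $\mathcal{T}\mathbf{f}(s,\theta)=\mathcal{T}\mathbf{h}(s,\theta)$ and $\mathcal{M}\mathbf{f}(s,\theta)=\mathcal{M}\mathbf{h}(s,\theta)$ for all $s\in\mathbb{R}$ and $\theta\in[0,2\pi)$, then $\mathbf{f}=\mathbf{h}$.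
   Context: Let $\mathbb{D}\subseteq\mathbb{R}^2$ be the (open) unit disk. $C_c^\infty(S^2;\mathbb{D})$ denotes the space of symmetric $2$-tensor fields $\mathbf{f}=(f_{ij})_{1\le i,j\le 2}$, $f_{12}=f_{21}$, whose components are smooth compactly supported functions on $\mathbb{D}$, extended by zero to $\mathbb{R}^2$. Fix constants $w_0>0$ and $\lambda>0$, and put $z_R=\pi w_0^2/\lambda$ and $w(u)=w_0\sqrt{1+(u/z_R)^2}$ for $u\in\mathbb{R}$. The Gaussian beam kernel is $$K(x_1,x_2)=\frac{w_0}{w(x_2)}\exp\left(-\frac{x_1^2}{w^2(x_2)}\right).$$ For an angle $\theta\in[0,2\pi)$ write $\boldsymbol{\theta}=(\theta_1,\theta_2)=(\cos\theta,\sin\theta)$ and $\boldsymbol{\theta}^\perp=(\theta_1^\perp,\theta_2^\perp)=(-\sin\theta,\cos\theta)$. For $s\in\mathbb{R}$ and $\theta\in[0,2\pi)$ define $$\mathcal{L}\mathbf{f}(s,\theta)=\int_{\mathbb{R}^2}K(s-\boldsymbol{\theta}\cdot\mathbf{x},\,\boldsymbol{\theta}^\perp\cdot\mathbf{x})\sum_{i,j=1}^2\theta_i^\perp\theta_j^\perp f_{ij}(\mathbf{x})\,d\mathbf{x},$$ $$\mathcal{T}\mathbf{f}(s,\theta)=\int_{\mathbb{R}^2}K(s-\boldsymbol{\theta}\cdot\mathbf{x},\,\boldsymbol{\theta}^\perp\cdot\mathbf{x})\sum_{i,j=1}^2\theta_i\theta_j f_{ij}(\mathbf{x})\,d\mathbf{x},$$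 $$\mathcal{M}\mathbf{f}(s,\theta)=\int_{\mathbb{R}^2}K(s-\boldsymbol{\theta}\cdot\mathbf{x},\,\boldsymbol{\theta}^\perp\cdot\mathbf{x})\sum_{i,j=1}^2\theta_i\theta_j^\perp f_{ij}(\mathbf{x})\,d\mathbf{x}.$$ *)

theory Defs
  imports "HOL-Analysis.Analysis"
begin

fun times_cont_diff_on :: "nat \<Rightarrow> 'a::real_normed_vector set \<Rightarrow> ('a \<Rightarrow> 'b::real_normed_vector) \<Rightarrow> bool" where
  "times_cont_diff_on 0 U g \<longleftrightarrow> continuous_on U g"
| "times_cont_diff_on (Suc k) U g \<longleftrightarrow>
     (\<forall>x\<in>U. g differentiable (at x)) \<and>
     (\<forall>v. times_cont_diff_on k U (\<lambda>x. frechet_derivative g (at x) v))"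

(* Only meaningful for open U, since derivatives are taken in the whole space. *)
definition smooth_on :: "'a::real_normed_vector set \<Rightarrow> ('a \<Rightarrow> 'b::real_normed_vector) \<Rightarrow> bool" where
  "smooth_on U g \<longleftrightarrow> (\<forall>k. times_cont_diff_on k U g)"

(* Test functions on U are represented by their extension by zero to the whole space:
   the support condition forces g to vanish outside U. *)
definition test_functions :: "'a::real_normed_vector set \<Rightarrow> ('a \<Rightarrow> real) set" where
  "test_functions U = {g. smooth_on U g \<and>
     compact (closure {x. g x \<noteq> 0}) \<and> closure {x. g x \<noteq> 0} \<subseteq> U}"

definition symmetric_tensor_fields :: "(real^2) set \<Rightarrow> (real^2 \<Rightarrow> real^2^2) set" where
  "symmetric_tensor_fields U = {f. (\<forall>x i j. f x $ i $ j = f x $ j $ i) \<and>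
     (\<forall>i j. (\<lambda>x. f x $ i $ j) \<in> test_functions U)}"

definition rayleigh_range :: "real \<Rightarrow> real \<Rightarrow> real" where
  "rayleigh_range w0 lam = pi * w0\<^sup>2 / lam"

definition beam_width :: "real \<Rightarrow> real \<Rightarrow> real \<Rightarrow> real" where
  "beam_width w0 lam u = w0 * sqrt (1 + (u / rayleigh_range w0 lam)\<^sup>2)"

definition beam_kernel :: "real \<Rightarrow> real \<Rightarrow> real \<Rightarrow> real \<Rightarrow> real" where
  "beam_kernel w0 lam x1 x2 =
     w0 / beam_width w0 lam x2 * exp (- (x1\<^sup>2 / (beam_width w0 lam x2)\<^sup>2))"

definition dir :: "real \<Rightarrow> real^2" where
  "dir \<theta> = vector [cos \<theta>, sin \<theta>]"

definition dir_perp :: "real \<Rightarrow> real^2" where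
  "dir_perp \<theta> = vector [- sin \<theta>, cos \<theta>]"

definition longitudinal_transform ::
  "real \<Rightarrow> real \<Rightarrow> (real^2 \<Rightarrow> real^2^2) \<Rightarrow> real \<Rightarrow> real \<Rightarrow> real" where
  "longitudinal_transform w0 lam f s \<theta> =
     (LINT x|lborel. beam_kernel w0 lam (s - dir \<theta> \<bullet> x) (dir_perp \<theta> \<bullet> x) *
        (\<Sum>i\<in>UNIV. \<Sum>j\<in>UNIV. dir_perp \<theta> $ i * dir_perp \<theta> $ j * f x $ i $ j))"

definition transverse_transform ::
  "real \<Rightarrow> real \<Rightarrow> (real^2 \<Rightarrow> real^2^2) \<Rightarrow> real \<Rightarrow> real \<Rightarrow> real" where
  "transverse_transform w0 lam f s \<theta> =
     (LINT x|lborel. beam_kernel w0 lam (s - dir \<theta> \<bullet> x) (dir_perp \<theta> \<bullet> x) *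
        (\<Sum>i\<in>UNIV. \<Sum>j\<in>UNIV. dir \<theta> $ i * dir \<theta> $ j * f x $ i $ j))"

definition mixed_transform ::
  "real \<Rightarrow> real \<Rightarrow> (real^2 \<Rightarrow> real^2^2) \<Rightarrow> real \<Rightarrow> real \<Rightarrow> real" where
  "mixed_transform w0 lam f s \<theta> =
     (LINT x|lborel. beam_kernel w0 lam (s - dir \<theta> \<bullet> x) (dir_perp \<theta> \<bullet> x) *
        (\<Sum>i\<in>UNIV. \<Sum>j\<in>UNIV. dir \<theta> $ i * dir_perp \<theta> $ j * f x $ i $ j))"

end

theory Submission
  imports Defs "HOL-Probability.Distributions"
begin

text \<open>At fixed \<open>s\<close> and \<open>\<theta>\<close> the three transforms are the components, in the orthonormal
  frame of \<open>dir \<theta>\<close> and \<open>dir_perp \<theta>\<close>, of the symmetric matrix of scalar beam transforms of the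
  Cartesian components of the field. Rotating back, the data determine the scalar beam transform of
  every component, so it suffices that the scalar transform is injective on continuous functions
  \<open>u\<close> that vanish outside the disk (\<open>beam_transform_injective\<close>).

  Write \<open>a = dir \<theta> \<bullet> x\<close>, \<open>b = dir_perp \<theta> \<bullet> x\<close>, let \<open>Z\<close> be a standard normal variable and
  \<open>\<kappa> = w0 / (sqrt 2 * z)\<close> with \<open>z\<close> the Rayleigh range. As a function of \<open>s\<close> the kernel is, up to a
  constant factor, the normal density with mean \<open>a\<close> and variance \<open>w0\<^sup>2 / 2 + \<kappa>\<^sup>2 b\<^sup>2\<close>. Hence the
  moments in \<open>s\<close> of a vanishing transform say that \<open>u\<close> is orthogonal to the heat polynomials
  \<open>H n a (w0\<^sup>2 / 2 + \<kappa>\<^sup>2 b\<^sup>2)\<close>, where \<open>H n a (\<sigma>\<^sup>2)\<close> is the mean of \<open>(a + \<sigma> Z) ^ n\<close>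
  (\<open>normal_mixture_moments\<close>). The constant part of the variance is a convolution with a fixed
  Gaussian, which acts on moments as a triangular matrix and can be cancelled
  (\<open>heat_flow_cancel\<close>). So \<open>u\<close> is orthogonal to the mean of \<open>(a + \<kappa> b Z) ^ n\<close> for all \<open>n\<close> and \<open>\<theta>\<close>.

  In the complex coordinate \<open>\<zeta> = x1 + \<i> x2\<close> one has
  \<open>a + \<kappa> b Z = Re (cis (- \<theta>) * \<zeta> * (1 - \<i> \<kappa> Z))\<close>. Expanding the power and comparing Fourier
  coefficients in \<open>\<theta>\<close> gives \<open>S p q * M p q = 0\<close> for all \<open>p\<close> and \<open>q\<close>, where \<open>M p q\<close> is the integral of
  \<open>u \<zeta> ^ p (cnj \<zeta>) ^ q\<close> and \<open>S p q\<close> the mean of \<open>(1 - \<i> \<kappa> Z) ^ p (1 + \<i> \<kappa> Z) ^ q\<close>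
  (\<open>symbol_times_moment_zero\<close>). The symbol can vanish: \<open>S 2 0 = 1 - \<kappa>\<^sup>2\<close>. But along each diagonal
  \<open>p = q + j\<close> it vanishes only finitely often (\<open>beam_symbol_diagonal_nonzero\<close>), and the finitely many
  moments that this leaves open follow from the others on the same diagonal by a limit
  (\<open>radial_moments_extend\<close>). Therefore all polynomial moments of \<open>u\<close> vanish, and \<open>u = 0\<close> by the
  Weierstrass approximation theorem (\<open>zero_if_complex_moments_zero\<close>).\<close>

section \<open>Heat polynomials and moments of the normal distribution\<close>

definition heat_coeff :: "nat \<Rightarrow> nat \<Rightarrow> real" where
  "heat_coeff n k = (if 2 * k \<le> n then fact n / (fact (n - 2 * k) * fact k * 2 ^ k) else 0)"

text \<open>The solution of the heat equation \<open>2 \<partial>\<^sub>t H = \<partial>\<^sub>a\<^sup>2 H\<close> with initial value \<open>a ^ n\<close>. It is written as a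
  polynomial in the variance \<open>t\<close> so that a variance can be split into a sum without square roots.\<close>

definition heat_poly :: "nat \<Rightarrow> real \<Rightarrow> real \<Rightarrow> real" where
  "heat_poly n a t = (\<Sum>k\<le>n. heat_coeff n k * a ^ (n - 2 * k) * t ^ k)"

lemma heat_coeff_mult_binomial:
  assumes "j \<le> k"
  shows "heat_coeff n k * real (k choose j) = heat_coeff n j * heat_coeff (n - 2 * j) (k - j)"
proof (cases "2 * k \<le> n")
  case True
  have pow: "(2::real) ^ k = 2 ^ j * 2 ^ (k - j)"
    using assms by (simp flip: power_add)
  have "n - 2 * j - 2 * (k - j) = n - 2 * k"
    using assms True by simp
  moreover have "2 * (k - j) \<le> n - 2 * j" "2 * j \<le> n"
    using assms True by linarith+
  ultimately show ?thesis
    using True assms by (simp add: heat_coeff_def binomial_fact pow field_simps)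
next
  case False
  then have "2 * j > n \<or> 2 * (k - j) > n - 2 * j"
    using assms by linarith
  then show ?thesis
    using False by (auto simp: heat_coeff_def)
qed

text \<open>Flowing for time \<open>s + t\<close> is flowing for time \<open>t\<close> and then for time \<open>s\<close>; the factors
  \<open>heat_coeff n j * s ^ j\<close> are those of the flow for time \<open>s\<close>. Only the term \<open>j = 0\<close> has the full
  degree \<open>n\<close>, which is what makes the flow invertible on moments.\<close>

lemma heat_poly_add:
  "heat_poly n a (s + t) = (\<Sum>j\<le>n. heat_coeff n j * s ^ j * heat_poly (n - 2 * j) a t)"
proof -
  define T where "T k j = heat_coeff n k * real (k choose j) * a ^ (n - 2 * k) * s ^ j * t ^ (k - j)" for k j
  have "heat_poly n a (s + t) = (\<Sum>k\<le>n. \<Sum>j\<le>k. T k j)"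
    by (simp add: heat_poly_def binomial_ring T_def sum_distrib_left mult_ac)
  also have "\<dots> = (\<Sum>k\<le>n. \<Sum>j\<le>n. if j \<le> k then T k j else 0)"
    by (intro sum.cong refl sum.mono_neutral_cong_left) auto
  also have "\<dots> = (\<Sum>j\<le>n. \<Sum>k\<le>n. if j \<le> k then T k j else 0)"
    by (rule sum.swap)
  also have "\<dots> = (\<Sum>j\<le>n. heat_coeff n j * s ^ j * heat_poly (n - 2 * j) a t)"
  proof (intro sum.cong refl)
    fix j assume "j \<in> {..n}"
    have "(\<Sum>k\<le>n. if j \<le> k then T k j else 0) = (\<Sum>k\<in>{j..n}. T k j)"
      by (intro sum.mono_neutral_cong_right) auto
    also have "\<dots> = (\<Sum>i\<le>n - j. T (i + j) j)"
      using \<open>j \<in> {..n}\<close>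
      by (intro sum.reindex_bij_witness[of _ "\<lambda>i. i + j" "\<lambda>k. k - j"]) auto
    also have "\<dots> = (\<Sum>i\<le>n - j. heat_coeff n j * s ^ j *
        (heat_coeff (n - 2 * j) i * a ^ (n - 2 * j - 2 * i) * t ^ i))"
    proof (intro sum.cong refl)
      fix i
      have "n - 2 * (i + j) = n - 2 * j - 2 * i" by simp
      then show "T (i + j) j = heat_coeff n j * s ^ j *
        (heat_coeff (n - 2 * j) i * a ^ (n - 2 * j - 2 * i) * t ^ i)"
        using heat_coeff_mult_binomial[of j "i + j" n] by (simp add: T_def mult_ac)
    qed
    also have "\<dots> = (\<Sum>i\<le>n - 2 * j. heat_coeff n j * s ^ j *
        (heat_coeff (n - 2 * j) i * a ^ (n - 2 * j - 2 * i) * t ^ i))"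
      by (intro sum.mono_neutral_right) (auto simp: heat_coeff_def)
    also have "\<dots> = heat_coeff n j * s ^ j * heat_poly (n - 2 * j) a t"
      by (simp add: heat_poly_def sum_distrib_left)
    finally show "(\<Sum>k\<le>n. if j \<le> k then T k j else 0) = heat_coeff n j * s ^ j * heat_poly (n - 2 * j) a t" .
  qed
  finally show ?thesis .
qed

lemma std_normal_moment:
  "has_bochner_integral lborel (\<lambda>z. std_normal_density z * z ^ m)
     (if even m then fact m / (2 ^ (m div 2) * fact (m div 2)) else 0)"
  using std_normal_moment_even[of "m div 2"] std_normal_moment_odd[of "m div 2"]
  by (cases "even m") (auto elim!: evenE oddE)

text \<open>The binomial theorem reduces this to the moments of the standard normal distribution, of which the
  odd ones vanish. The deviation \<open>\<sigma>\<close> may have any sign: below it is \<open>\<kappa> * b\<close>, which has the sign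
  of \<open>b\<close>.\<close>

lemma gaussian_mean_affine_power:
  "has_bochner_integral lborel (\<lambda>z. std_normal_density z * (a + \<sigma> * z) ^ n) (heat_poly n a (\<sigma>\<^sup>2))"
proof -
  define \<mu> :: "nat \<Rightarrow> real" where "\<mu> m = (if even m then fact m / (2 ^ (m div 2) * fact (m div 2)) else 0)" for m
  define T where "T m = real (n choose m) * \<sigma> ^ m * a ^ (n - m) * \<mu> m" for m
  have "has_bochner_integral lborel (\<lambda>z. \<Sum>m\<le>n. real (n choose m) * \<sigma> ^ m * a ^ (n - m) * (std_normal_density z * z ^ m))
      (\<Sum>m\<le>n. T m)"
    unfolding T_def \<mu>_def
    by (intro has_bochner_integral_sum has_bochner_integral_mult_right std_normal_moment)
  moreover have "(\<Sum>m\<le>n. real (n choose m) * \<sigma> ^ m * a ^ (n - m) * (std_normal_density z * z ^ m)) =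
      std_normal_density z * (a + \<sigma> * z) ^ n" for z
    unfolding add.commute[of a] binomial_ring by (simp add: sum_distrib_left power_mult_distrib mult_ac)
  moreover have "(\<Sum>m\<le>n. T m) = heat_poly n a (\<sigma>\<^sup>2)"
  proof -
    have "(\<Sum>m\<le>n. T m) = (\<Sum>m\<in>{m. m \<le> n \<and> even m}. T m)"
      by (intro sum.mono_neutral_right) (auto simp: T_def \<mu>_def)
    also have "\<dots> = (\<Sum>k\<in>{k. 2 * k \<le> n}. T (2 * k))"
      by (intro sum.reindex_bij_witness[of _ "\<lambda>k. 2 * k" "\<lambda>m. m div 2"]) auto
    also have "\<dots> = (\<Sum>k\<in>{k. 2 * k \<le> n}. heat_coeff n k * a ^ (n - 2 * k) * (\<sigma>\<^sup>2) ^ k)"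
    proof (intro sum.cong refl)
      fix k assume "k \<in> {k. 2 * k \<le> n}"
      then have "real (n choose (2 * k)) * \<mu> (2 * k) = heat_coeff n k"
        by (simp add: \<mu>_def heat_coeff_def binomial_fact)
      then show "T (2 * k) = heat_coeff n k * a ^ (n - 2 * k) * (\<sigma>\<^sup>2) ^ k"
        by (simp add: T_def flip: power_mult)
    qed
    also have "\<dots> = heat_poly n a (\<sigma>\<^sup>2)"
      unfolding heat_poly_def by (intro sum.mono_neutral_left) (auto simp: heat_coeff_def)
    finally show ?thesis .
  qed
  ultimately show ?thesis by simp
qed

lemma normal_density_moment:
  assumes "\<sigma> > 0"
  shows "has_bochner_integral lborel (\<lambda>s. normal_density a \<sigma> s * s ^ n) (heat_poly n a (\<sigma>\<^sup>2))"
proof -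
  have "has_bochner_integral lborel (\<lambda>z. std_normal_density z * (a + \<sigma> * z) ^ n) (heat_poly n a (\<sigma>\<^sup>2))"
    by (rule gaussian_mean_affine_power)
  moreover have "std_normal_density z * (a + \<sigma> * z) ^ n = \<sigma> * (normal_density a \<sigma> (a + \<sigma> * z) * (a + \<sigma> * z) ^ n)" for z
    using assms by (simp add: normal_density_def power_mult_distrib real_sqrt_mult)
  ultimately have "has_bochner_integral lborel (\<lambda>z. \<sigma> * (normal_density a \<sigma> (a + \<sigma> * z) * (a + \<sigma> * z) ^ n))
     (heat_poly n a (\<sigma>\<^sup>2))" by simp
  from has_bochner_integral_mult_right[OF this, of "1 / \<sigma>"]
  have "has_bochner_integral lborel (\<lambda>z. normal_density a \<sigma> (a + \<sigma> * z) * (a + \<sigma> * z) ^ n)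
     (heat_poly n a (\<sigma>\<^sup>2) / \<sigma>)" using assms by simp
  then show ?thesis
    using lborel_has_bochner_integral_real_affine_iff[of \<sigma> "\<lambda>s. normal_density a \<sigma> s * s ^ n" "heat_poly n a (\<sigma>\<^sup>2)" a] assms
    by (simp add: divide_inverse_commute)
qed

lemma heat_poly_0 [simp]: "heat_poly 0 a t = 1"
  by (simp add: heat_poly_def heat_coeff_def)

lemma continuous_on_heat_poly [continuous_intros]:
  assumes "continuous_on S a" "continuous_on S t"
  shows "continuous_on S (\<lambda>x. heat_poly n (a x) (t x))"
  unfolding heat_poly_def by (intro continuous_intros assms)

section \<open>Moments of the beam transform in the offset\<close>

definition disk_supported :: "(real^2 \<Rightarrow> 'b::real_normed_vector) \<Rightarrow> bool" where
  "disk_supported u \<longleftrightarrow> continuous_on UNIV u \<and> (\<forall>x. norm x \<ge> 1 \<longrightarrow> u x = 0)"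

lemma disk_supported_continuous: "disk_supported u \<Longrightarrow> continuous_on UNIV u"
  by (simp add: disk_supported_def)

lemma disk_supported_integrable:
  fixes u :: "real^2 \<Rightarrow> 'b::{banach, second_countable_topology}"
  assumes "disk_supported u"
  shows "integrable lborel u"
proof -
  have "integrable lborel (\<lambda>x. indicator (cball 0 1) x *\<^sub>R u x)"
    using assms by (intro borel_integrable_compact)
      (auto intro: continuous_on_subset simp: disk_supported_def)
  moreover have "(\<lambda>x. indicator (cball 0 1) x *\<^sub>R u x) = u"
    using assms by (auto simp: fun_eq_iff disk_supported_def indicator_def)
  ultimately show ?thesis by simp
qed

lemma disk_supported_mult:
  fixes u :: "real^2 \<Rightarrow> 'b::real_normed_algebra"
  assumes "disk_supported u" "continuous_on UNIV p"
  shows "disk_supported (\<lambda>x. u x * p x)"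
  using assms by (auto simp: disk_supported_def intro!: continuous_intros)

lemma disk_supported_integrable_mult:
  fixes u :: "real^2 \<Rightarrow> 'b::{banach, real_normed_algebra, second_countable_topology}"
  assumes "disk_supported u" "continuous_on UNIV p"
  shows "integrable lborel (\<lambda>x. u x * p x)"
  by (intro disk_supported_integrable disk_supported_mult assms)

text \<open>Multiply by \<open>s ^ n\<close>, integrate over \<open>s\<close> and exchange the integrals. The absolute moments needed
  for the exchange are bounded through \<open>\<bar>s\<bar> ^ n \<le> 1 + s ^ (2 * n)\<close> by two even moments, which are
  polynomials in \<open>a\<close> and \<open>v\<close> and hence continuous.\<close>

lemma normal_mixture_moments:
  fixes u a v :: "real^2 \<Rightarrow> real"
  assumes u: "disk_supported u" and a: "continuous_on UNIV a" and v: "continuous_on UNIV v"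
    and v_pos: "\<And>x. v x > 0"
    and zero: "\<And>s. (LINT x|lborel. normal_density (a x) (sqrt (v x)) s * u x) = 0"
  shows "(LINT x|lborel. u x * heat_poly n (a x) (v x)) = 0"
proof -
  have [measurable]: "u \<in> borel_measurable borel" "a \<in> borel_measurable borel" "v \<in> borel_measurable borel"
    using u a v by (auto intro!: borel_measurable_continuous_onI simp: disk_supported_def)
  define F where "F x s = normal_density (a x) (sqrt (v x)) s * s ^ n * u x" for x s
  have F_meas [measurable]: "case_prod F \<in> borel_measurable (borel \<Otimes>\<^sub>M borel)"
    unfolding F_def normal_density_def by measurable
  note moment = normal_density_moment[OF real_sqrt_gt_zero[OF v_pos]]
  have sq: "(sqrt (v x))\<^sup>2 = v x" for x
    using v_pos[of x] by simp
  have int_F: "has_bochner_integral lborel (F x) (u x * heat_poly n (a x) (v x))" for x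
    using has_bochner_integral_mult_right[OF moment[of "a x" x n], of "u x"]
    by (simp add: F_def[abs_def] sq mult_ac)
  have "integrable (lborel \<Otimes>\<^sub>M lborel) (case_prod F)"
  proof (rule lborel_pair.Fubini_integrable)
    show "case_prod F \<in> borel_measurable (lborel \<Otimes>\<^sub>M lborel)" by simp
    show "AE x in lborel. integrable lborel (\<lambda>s. case_prod F (x, s))"
      using int_F by (auto intro: integrable.intros)
    show "integrable lborel (\<lambda>x. LINT s|lborel. norm (case_prod F (x, s)))"
    proof (rule Bochner_Integration.integrable_bound)
      show "integrable lborel (\<lambda>x. u x * (1 + heat_poly (2 * n) (a x) (v x)))"
        by (intro disk_supported_integrable_mult u continuous_intros a v)
      show "(\<lambda>x. LINT s|lborel. norm (case_prod F (x, s))) \<in> borel_measurable lborel"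
        by measurable
      show "AE x in lborel. norm (LINT s|lborel. norm (case_prod F (x, s)))
          \<le> norm (u x * (1 + heat_poly (2 * n) (a x) (v x)))"
      proof (intro AE_I2)
        fix x
        define G where "G s = \<bar>u x\<bar> * (normal_density (a x) (sqrt (v x)) s * s ^ 0 +
            normal_density (a x) (sqrt (v x)) s * s ^ (2 * n))" for s
        have G: "has_bochner_integral lborel G (\<bar>u x\<bar> * (1 + heat_poly (2 * n) (a x) (v x)))"
          using has_bochner_integral_mult_right[OF has_bochner_integral_add[OF moment[of "a x" x 0]
            moment[of "a x" x "2 * n"]], of "\<bar>u x\<bar>"]
          by (simp add: G_def[abs_def] sq)
        have "norm (F x s) \<le> G s" for s
        proof -
          have "\<bar>s\<bar> ^ n \<le> 1 + s ^ (2 * n)"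
          proof (cases "\<bar>s\<bar> ^ n \<le> 1")
            case False
            then have "\<bar>s\<bar> ^ n * 1 \<le> \<bar>s\<bar> ^ n * \<bar>s\<bar> ^ n" by (intro mult_left_mono) auto
            also have "\<dots> = s ^ (2 * n)" by (simp add: power_even_abs flip: power_add mult_2)
            finally show ?thesis by simp
          qed (simp add: add_increasing2)
          then have "\<bar>u x\<bar> * normal_density (a x) (sqrt (v x)) s * \<bar>s\<bar> ^ n \<le>
             \<bar>u x\<bar> * normal_density (a x) (sqrt (v x)) s * (1 + s ^ (2 * n))"
            by (intro mult_left_mono) auto
          then show ?thesis by (simp add: F_def G_def abs_mult power_abs algebra_simps)
        qed
        then have "(LINT s|lborel. norm (F x s)) \<le> (LINT s|lborel. G s)"
          using int_F G by (intro integral_mono integrable_norm) (auto intro: integrable.intros)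
        also have "\<dots> = \<bar>u x\<bar> * (1 + heat_poly (2 * n) (a x) (v x))"
          using G by (simp add: has_bochner_integral_integral_eq)
        also have "\<dots> \<le> norm (u x * (1 + heat_poly (2 * n) (a x) (v x)))"
          by (simp add: abs_mult mult_left_mono)
        finally show "norm (LINT s|lborel. norm (case_prod F (x, s)))
          \<le> norm (u x * (1 + heat_poly (2 * n) (a x) (v x)))" by simp
      qed
    qed
  qed
  then have "(LINT s|lborel. LINT x|lborel. F x s) = (LINT x|lborel. LINT s|lborel. F x s)"
    by (rule lborel_pair.Fubini_integral)
  moreover have "(LINT x|lborel. F x s) = 0" for s
  proof -
    have "(LINT x|lborel. F x s) = (LINT x|lborel. s ^ n * (normal_density (a x) (sqrt (v x)) s * u x))"
      by (simp add: F_def mult_ac)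
    then show ?thesis using zero by simp
  qed
  ultimately show ?thesis
    using has_bochner_integral_integral_eq[OF int_F] by simp
qed

text \<open>Induction on the degree: in the expansion of \<open>heat_poly_add\<close> all terms except the one with
  \<open>j = 0\<close> have smaller degree, so their integrals are already known to vanish.\<close>

lemma heat_flow_cancel:
  fixes u a t :: "real^2 \<Rightarrow> real"
  assumes u: "disk_supported u" and a: "continuous_on UNIV a" and t: "continuous_on UNIV t"
    and zero: "\<And>n. (LINT x|lborel. u x * heat_poly n (a x) (A + t x)) = 0"
  shows "(LINT x|lborel. u x * heat_poly n (a x) (t x)) = 0"
proof (induction n rule: less_induct)
  case (less n)
  have int: "integrable lborel (\<lambda>x. u x * heat_poly m (a x) (t x))" for m
    by (intro disk_supported_integrable_mult u continuous_intros a t)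
  have "0 = (LINT x|lborel. (\<Sum>j\<le>n. heat_coeff n j * A ^ j * (u x * heat_poly (n - 2 * j) (a x) (t x))))"
    using zero[of n] unfolding heat_poly_add by (simp add: sum_distrib_left mult_ac)
  also have "\<dots> = (\<Sum>j\<le>n. heat_coeff n j * A ^ j * (LINT x|lborel. u x * heat_poly (n - 2 * j) (a x) (t x)))"
    using int by simp
  also have "\<dots> = (\<Sum>j\<in>{0}. heat_coeff n j * A ^ j * (LINT x|lborel. u x * heat_poly (n - 2 * j) (a x) (t x)))"
    using less.IH by (intro sum.mono_neutral_right) auto
  finally show ?case by (simp add: heat_coeff_def)
qed

text \<open>The beam width satisfies \<open>w(b)\<^sup>2 = w0\<^sup>2 + (w0 * b / z)\<^sup>2\<close> with \<open>z\<close> the Rayleigh range, and the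
  Gaussian \<open>exp (- y\<^sup>2 / w\<^sup>2)\<close> has variance \<open>w\<^sup>2 / 2\<close>.\<close>

lemma beam_kernel_eq_normal_density:
  assumes "w0 > 0" "lam > 0"
  shows "beam_kernel w0 lam (s - a) b = w0 * sqrt pi *
    normal_density a (sqrt (w0\<^sup>2 / 2 + (w0 / (sqrt 2 * rayleigh_range w0 lam) * b)\<^sup>2)) s"
proof -
  define W where "W = beam_width w0 lam b"
  define v where "v = w0\<^sup>2 / 2 + (w0 / (sqrt 2 * rayleigh_range w0 lam) * b)\<^sup>2"
  have "W > 0"
    unfolding W_def beam_width_def using assms by (intro mult_pos_pos) (auto intro: add_pos_nonneg)
  have "W\<^sup>2 = 2 * v"
    by (simp add: W_def v_def beam_width_def power_mult_distrib power_divide field_simps)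
  moreover have "v > 0"
    using \<open>W > 0\<close> \<open>W\<^sup>2 = 2 * v\<close> by (metis zero_less_mult_pos zero_less_numeral zero_less_power)
  moreover have "sqrt (2 * pi * v) = W * sqrt pi"
    using \<open>W > 0\<close> \<open>W\<^sup>2 = 2 * v\<close> by (intro real_sqrt_unique) (auto simp: power_mult_distrib)
  ultimately show ?thesis
    unfolding beam_kernel_def normal_density_def W_def[symmetric] v_def[symmetric] by simp
qed

section \<open>Asymptotic positivity of weighted Gaussian means\<close>

lemma integrable_std_normal_poly:
  fixes P :: "real poly"
  shows "integrable lborel (\<lambda>z. std_normal_density z * poly P z)"
proof -
  have "integrable lborel (\<lambda>z. \<Sum>i\<le>degree P. coeff P i * (std_normal_density z * z ^ i))"
    by (intro Bochner_Integration.integrable_sum integrable_mult_right integrable_std_normal_moment)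
  then show ?thesis by (simp add: poly_altdef sum_distrib_left mult_ac)
qed

lemma one_plus_imaginary_power_poly:
  "\<exists>P Q. \<forall>z. (1 + \<i> * of_real (\<kappa> * z)) ^ j = Complex (poly P z) (poly Q z)"
proof (induction j)
  case 0
  show ?case by (intro exI[of _ 1] exI[of _ 0]) (simp add: complex_eq_iff)
next
  case (Suc j)
  then obtain P Q where PQ: "\<And>z. (1 + \<i> * of_real (\<kappa> * z)) ^ j = Complex (poly P z) (poly Q z)"
    by blast
  show ?case
    by (intro exI[of _ "P - [:0, \<kappa>:] * Q"] exI[of _ "Q + [:0, \<kappa>:] * P"])
      (simp only: power_Suc PQ, simp add: complex_eq_iff algebra_simps)
qed

text \<open>For large \<open>q\<close> the weight \<open>(1 + (\<kappa> * z)\<^sup>2) ^ q\<close> concentrates the mean where \<open>\<bar>z\<bar>\<close> is large, and there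
  an even polynomial with positive leading coefficient is bounded below by a positive constant.
  Quantitatively, choose \<open>R\<close> such that \<open>P\<close> is bounded below by \<open>l > 0\<close> outside \<open>{-R..R}\<close>; then the
  contribution of \<open>{2*R..3*R}\<close> grows at least like the power of a larger base than that of \<open>{-R..R}\<close>.\<close>

lemma eventually_gaussian_mean_pos:
  fixes P :: "real poly"
  assumes "\<kappa> \<noteq> 0" and lc: "lead_coeff P > 0" and even: "\<And>z. poly P (- z) = poly P z"
  shows "\<forall>\<^sub>F q in sequentially. (LINT z|lborel. std_normal_density z * ((1 + (\<kappa> * z)\<^sup>2) ^ q * poly P z)) > 0"
proof -
  define l where "l = lead_coeff P"
  have "l > 0" using lc by (simp add: l_def)
  obtain n where n: "\<And>z. z \<ge> n \<Longrightarrow> poly P z \<ge> l"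
    using poly_pinfty_gt_lc[OF lc] by (auto simp: l_def)
  define R where "R = max n 1"
  have "R \<ge> 1" by (simp add: R_def)
  have outer: "poly P z \<ge> l" if "\<bar>z\<bar> \<ge> R" for z
    using n[of z] n[of "- z"] that by (auto simp: even R_def abs_if split: if_splits)
  have "compact (poly P ` {-R..R})"
    by (intro compact_continuous_image continuous_intros) auto
  then obtain C where C: "\<And>z. z \<in> {-R..R} \<Longrightarrow> \<bar>poly P z\<bar> \<le> C" and "C > 0"
    by (fastforce dest!: compact_imp_bounded simp: bounded_pos)
  define d where "d = std_normal_density (3 * R)"
  have "d > 0" by (simp add: d_def normal_density_pos)
  define a b where "a = 1 + (\<kappa> * (2 * R))\<^sup>2" and "b = 1 + (\<kappa> * R)\<^sup>2"
  have "0 < b" "b < a"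
    using \<open>\<kappa> \<noteq> 0\<close> \<open>R \<ge> 1\<close> by (auto simp: a_def b_def power_mult_distrib add_pos_nonneg)
  have dl: "d * l * R > 0" and "a / b > 1"
    using \<open>d > 0\<close> \<open>l > 0\<close> \<open>R \<ge> 1\<close> \<open>0 < b\<close> \<open>b < a\<close> by auto
  from real_arch_pow[OF this(2)] obtain q0 where "2 * C * R / (d * l * R) < (a / b) ^ q0"
    by blast
  also have "(a / b) ^ q0 \<le> (a / b) ^ q" if "q \<ge> q0" for q
    using that \<open>a / b > 1\<close> by (intro power_increasing) auto
  finally have "d * l * R * (a / b) ^ q > 2 * C * R" if "q \<ge> q0" for q
    using that unfolding pos_divide_less_eq[OF dl] by (simp only: mult.commute)
  then have "\<forall>\<^sub>F q in sequentially. d * l * R * (a / b) ^ q > 2 * C * R"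
    unfolding eventually_sequentially by blast
  then show ?thesis
  proof eventually_elim
    case (elim q)
    \<comment> \<open>A step function below the integrand: its gain on the outer interval beats its loss on the inner one.\<close>
    define h where "h z = a ^ q * l * d * indicator {2*R..3*R} z - b ^ q * C * indicator {-R..R} z" for z :: real
    have h_int: "has_bochner_integral lborel h (a ^ q * l * d * R - b ^ q * C * (2 * R))"
    proof -
      have indicator: "has_bochner_integral lborel (indicator {x..y}) (y - x)" if "x \<le> y" for x y :: real
        using that has_bochner_integral_real_indicator[of "{x..y}" lborel] by simp
      have *: "has_bochner_integral lborel (indicator {2*R..3*R}) R"
        "has_bochner_integral lborel (indicator {-R..R}) (2 * R)"
        using indicator[of "2 * R" "3 * R"] indicator[of "- R" R] \<open>R \<ge> 1\<close> by simp_all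
      show ?thesis
        unfolding h_def by (intro has_bochner_integral_diff has_bochner_integral_mult_right *)
    qed
    have "0 < b ^ q * (d * l * R * (a / b) ^ q - 2 * C * R)"
      using elim \<open>0 < b\<close> by simp
    also have "\<dots> = (LINT z|lborel. h z)"
    proof -
      have "b ^ q * (a / b) ^ q = a ^ q"
        using \<open>0 < b\<close> by (simp add: power_divide)
      then have "b ^ q * (d * l * R * (a / b) ^ q - 2 * C * R) = a ^ q * l * d * R - b ^ q * C * (2 * R)"
        by (simp add: right_diff_distrib mult.left_commute[of "b ^ q"])
      then show ?thesis
        by (simp only: has_bochner_integral_integral_eq[OF h_int])
    qed
    also have "\<dots> \<le> (LINT z|lborel. std_normal_density z * ((1 + (\<kappa> * z)\<^sup>2) ^ q * poly P z))"
    proof (rule integral_mono)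
      show "integrable lborel h" using h_int by (rule integrable.intros)
      show "integrable lborel (\<lambda>z. std_normal_density z * ((1 + (\<kappa> * z)\<^sup>2) ^ q * poly P z))"
        using integrable_std_normal_poly[of "[:1, 0, \<kappa>\<^sup>2:] ^ q * P"]
        by (simp add: power2_eq_square mult_ac)
      fix z :: real
      consider "\<bar>z\<bar> \<le> R" | "\<bar>z\<bar> > R" "z \<notin> {2*R..3*R}" | "z \<in> {2*R..3*R}"
        using not_le by blast
      then show "h z \<le> std_normal_density z * ((1 + (\<kappa> * z)\<^sup>2) ^ q * poly P z)"
      proof cases
        case 1
        have "std_normal_density z \<le> 1"
        proof -
          have "1 \<le> sqrt (2 * pi)" using pi_gt3 by simp
          moreover have "exp (- z\<^sup>2 / 2) \<le> 1" by simp
          ultimately show ?thesis unfolding std_normal_density_def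
            by (intro mult_le_one) auto
        qed
        moreover have "(1 + (\<kappa> * z)\<^sup>2) ^ q \<le> b ^ q"
        proof -
          have "z\<^sup>2 \<le> R\<^sup>2"
            using 1 \<open>R \<ge> 1\<close> by (intro abs_le_square_iff[THEN iffD1]) simp
          from mult_left_mono[OF this zero_le_power2[of \<kappa>]] show ?thesis
            unfolding b_def power_mult_distrib by (intro power_mono[of "1 + _"]) auto
        qed
        ultimately have "std_normal_density z * (1 + (\<kappa> * z)\<^sup>2) ^ q * \<bar>poly P z\<bar> \<le> 1 * b ^ q * C"
          using C[of z] 1 \<open>0 < b\<close> by (intro mult_mono) (auto simp: abs_le_iff)
        moreover have "- (std_normal_density z * (1 + (\<kappa> * z)\<^sup>2) ^ q * \<bar>poly P z\<bar>)
            \<le> std_normal_density z * (1 + (\<kappa> * z)\<^sup>2) ^ q * poly P z"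
          unfolding mult_minus_right[symmetric] by (intro mult_left_mono) auto
        ultimately show ?thesis
          using 1 \<open>R \<ge> 1\<close> by (auto simp: h_def indicator_def mult_ac)
      next
        case 2
        then have "poly P z \<ge> 0" using outer[of z] \<open>l > 0\<close> by linarith
        with 2 show ?thesis by (auto simp: h_def indicator_def)
      next
        case 3
        then have "z > R" "z \<ge> 0" using \<open>R \<ge> 1\<close> by auto
        have "d \<le> std_normal_density z"
        proof -
          have "z\<^sup>2 \<le> (3 * R)\<^sup>2"
            using 3 \<open>z \<ge> 0\<close> by (intro power_mono) auto
          then show ?thesis
            by (simp add: d_def std_normal_density_def divide_right_mono)
        qed
        moreover have "a ^ q \<le> (1 + (\<kappa> * z)\<^sup>2) ^ q"
        proof -
          have "(2 * R)\<^sup>2 \<le> z\<^sup>2"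
            using 3 \<open>R \<ge> 1\<close> by (intro power_mono) auto
          from mult_left_mono[OF this zero_le_power2[of \<kappa>]] show ?thesis
            unfolding a_def power_mult_distrib[of \<kappa>] by (intro power_mono[of "1 + _"]) auto
        qed
        moreover have "l \<le> poly P z" using outer[of z] \<open>z > R\<close> by auto
        ultimately have "d * (a ^ q * l) \<le> std_normal_density z * ((1 + (\<kappa> * z)\<^sup>2) ^ q * poly P z)"
          using \<open>d > 0\<close> \<open>l > 0\<close> \<open>0 < b\<close> \<open>b < a\<close> by (intro mult_mono) auto
        with 3 \<open>z > R\<close> show ?thesis by (auto simp: h_def indicator_def mult_ac)
      qed
    qed
    finally show ?case .
  qed
qed

section \<open>Fourier expansion in the direction\<close>

definition plane_complex :: "real^2 \<Rightarrow> complex" where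
  "plane_complex x = Complex (x $ 1) (x $ 2)"

lemma continuous_on_plane_complex [continuous_intros]: "continuous_on S plane_complex"
proof -
  have eq: "plane_complex = (\<lambda>x. of_real (x $ 1) + \<i> * of_real (x $ 2))"
    by (simp add: fun_eq_iff plane_complex_def complex_eq_iff)
  show ?thesis unfolding eq by (intro continuous_intros)
qed

text \<open>Up to a binomial constant, the factor by which the integral of \<open>u * (\<zeta> ^ p * cnj \<zeta> ^ q)\<close>, with
  \<open>\<zeta>\<close> the complex coordinate, enters the moments of the data of degree \<open>p + q\<close>.\<close>

definition beam_symbol :: "real \<Rightarrow> nat \<Rightarrow> nat \<Rightarrow> complex" where
  "beam_symbol \<kappa> p q = (LINT z|lborel. of_real (std_normal_density z) *
     ((1 - \<i> * of_real (\<kappa> * z)) ^ p * (1 + \<i> * of_real (\<kappa> * z)) ^ q))"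

lemma integrable_beam_symbol:
  "integrable lborel (\<lambda>z. complex_of_real (std_normal_density z) *
     ((1 - \<i> * of_real (\<kappa> * z)) ^ p * (1 + \<i> * of_real (\<kappa> * z)) ^ q))"
proof (rule Bochner_Integration.integrable_bound)
  show "integrable lborel (\<lambda>z. std_normal_density z * poly ([:1, 0, \<kappa>\<^sup>2:] ^ (p + q)) z)"
    by (rule integrable_std_normal_poly)
  show "AE z in lborel. norm (complex_of_real (std_normal_density z) *
     ((1 - \<i> * of_real (\<kappa> * z)) ^ p * (1 + \<i> * of_real (\<kappa> * z)) ^ q))
     \<le> norm (std_normal_density z * poly ([:1, 0, \<kappa>\<^sup>2:] ^ (p + q)) z)"
  proof (intro AE_I2)
    fix z
    have "sqrt (1 + y) \<le> 1 + y" if "y \<ge> 0" for y :: real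
      using that by (intro real_le_lsqrt) (auto simp: power2_eq_square algebra_simps)
    then have le: "sqrt (1 + (\<kappa> * z)\<^sup>2) \<le> 1 + (\<kappa> * z)\<^sup>2" by simp
    have n: "norm (1 - \<i> * of_real (\<kappa> * z)) \<le> 1 + (\<kappa> * z)\<^sup>2"
      "norm (1 + \<i> * of_real (\<kappa> * z)) \<le> 1 + (\<kappa> * z)\<^sup>2"
      using le by (simp_all add: cmod_def)
    have "norm ((1 - \<i> * of_real (\<kappa> * z)) ^ p * (1 + \<i> * of_real (\<kappa> * z)) ^ q)
       \<le> (1 + (\<kappa> * z)\<^sup>2) ^ p * (1 + (\<kappa> * z)\<^sup>2) ^ q"
      unfolding norm_mult norm_power by (intro mult_mono power_mono n) auto
    also have "\<dots> = poly ([:1, 0, \<kappa>\<^sup>2:] ^ (p + q)) z"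
      by (simp add: power_add power2_eq_square mult_ac)
    finally show "norm (complex_of_real (std_normal_density z) *
     ((1 - \<i> * of_real (\<kappa> * z)) ^ p * (1 + \<i> * of_real (\<kappa> * z)) ^ q))
     \<le> norm (std_normal_density z * poly ([:1, 0, \<kappa>\<^sup>2:] ^ (p + q)) z)"
      unfolding norm_mult[of "complex_of_real _"] norm_mult[of "std_normal_density z"]
      by (intro mult_mono) auto
  qed
qed measurable

text \<open>Rotating by \<open>- \<theta>\<close> turns \<open>plane_complex x\<close> into \<open>w = a + \<i> b\<close>, and then
  \<open>a + \<kappa> * b * z = Re (w * (1 - \<i> * \<kappa> * z))\<close>. The binomial theorem for this real part, written as half
  the sum of the number and its conjugate, separates \<open>x\<close> and \<open>\<theta>\<close> from the Gaussian variable \<open>z\<close>.\<close>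

lemma heat_poly_angular_expansion:
  "complex_of_real (heat_poly n (dir \<theta> \<bullet> x) ((\<kappa> * (dir_perp \<theta> \<bullet> x))\<^sup>2)) =
    (\<Sum>p\<le>n. of_nat (n choose p) * beam_symbol \<kappa> p (n - p) / 2 ^ n *
      (cis (- \<theta>) * plane_complex x) ^ p * (cis \<theta> * cnj (plane_complex x)) ^ (n - p))"
proof -
  define a b where "a = dir \<theta> \<bullet> x" and "b = dir_perp \<theta> \<bullet> x"
  define w where "w = cis (- \<theta>) * plane_complex x"
  have w: "w = Complex a b"
    by (simp add: w_def a_def b_def plane_complex_def dir_def dir_perp_def complex_eq_iff
        inner_vec_def sum_2 vector_2)
  have cnj_w: "cnj w = cis \<theta> * cnj (plane_complex x)"
    by (simp add: w_def cis_cnj)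
  define E where "E p z = of_real (std_normal_density z) *
     ((1 - \<i> * of_real (\<kappa> * z)) ^ p * (1 + \<i> * of_real (\<kappa> * z)) ^ (n - p))" for p z
  define c where "c p = of_nat (n choose p) / 2 ^ n * w ^ p * cnj w ^ (n - p)" for p
  have "complex_of_real (heat_poly n a ((\<kappa> * b)\<^sup>2)) =
      (LINT z|lborel. complex_of_real (std_normal_density z * (a + \<kappa> * b * z) ^ n))"
    using has_bochner_integral_of_real[OF gaussian_mean_affine_power[of a "\<kappa> * b" n], where 'a = complex]
    by (simp only: has_bochner_integral_integral_eq)
  also have "\<dots> = (LINT z|lborel. (\<Sum>p\<le>n. c p * E p z))"
  proof (intro Bochner_Integration.integral_cong refl)
    fix z
    have "complex_of_real (a + \<kappa> * b * z) =
        (w * (1 - \<i> * of_real (\<kappa> * z)) + cnj w * (1 + \<i> * of_real (\<kappa> * z))) / 2"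
      by (simp add: w complex_eq_iff algebra_simps)
    then have "complex_of_real (std_normal_density z * (a + \<kappa> * b * z) ^ n) =
       of_real (std_normal_density z) *
         ((w * (1 - \<i> * of_real (\<kappa> * z)) + cnj w * (1 + \<i> * of_real (\<kappa> * z))) ^ n / 2 ^ n)"
      by (simp only: of_real_mult of_real_power power_divide)
    also have "\<dots> = (\<Sum>p\<le>n. c p * E p z)"
      unfolding binomial_ring[of "w * _"] c_def E_def
      by (simp only: sum_distrib_left sum_divide_distrib power_mult_distrib)
        (intro sum.cong refl, simp only: times_divide_eq_left times_divide_eq_right mult_ac)
    finally show "complex_of_real (std_normal_density z * (a + \<kappa> * b * z) ^ n) = (\<Sum>p\<le>n. c p * E p z)" .
  qed
  also have "\<dots> = (\<Sum>p\<le>n. c p * beam_symbol \<kappa> p (n - p))"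
    unfolding beam_symbol_def E_def
    by (subst Bochner_Integration.integral_sum) (auto intro: integrable_beam_symbol[simplified])
  finally show ?thesis
    unfolding a_def b_def c_def cnj_w unfolding w_def by (simp add: mult_ac)
qed

text \<open>On the diagonal \<open>p = q + j\<close> the integrand is \<open>(1 + (\<kappa> * z)\<^sup>2) ^ q * (1 - \<i> * \<kappa> * z) ^ j\<close>. The real
  part of the second factor is an even polynomial with value \<open>1\<close> at \<open>0\<close>, hence not the zero
  polynomial, and one of it and its negative has a positive leading coefficient.\<close>

lemma beam_symbol_diagonal_nonzero:
  assumes "\<kappa> \<noteq> 0"
  shows "\<forall>\<^sub>F q in sequentially. beam_symbol \<kappa> (q + j) q \<noteq> 0"
proof -
  obtain P Q where PQ: "\<And>z. (1 + \<i> * of_real (- \<kappa> * z)) ^ j = Complex (poly P z) (poly Q z)"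
    using one_plus_imaginary_power_poly[of "- \<kappa>" j] by blast
  have Re: "poly P z = Re ((1 - \<i> * of_real (\<kappa> * z)) ^ j)" for z
    using PQ[of z] by simp
  have even: "poly P (- z) = poly P z" for z
  proof -
    have "(1 - \<i> * of_real (\<kappa> * (- z))) ^ j = cnj ((1 - \<i> * of_real (\<kappa> * z)) ^ j)"
      by simp
    then show ?thesis unfolding Re by (simp only: cnj.sel)
  qed
  have "poly P 0 = 1" by (simp add: Re)
  then have "P \<noteq> 0" by auto
  have Re_symbol: "Re (beam_symbol \<kappa> (q + j) q) =
      (LINT z|lborel. std_normal_density z * ((1 + (\<kappa> * z)\<^sup>2) ^ q * poly P z))" for q
  proof -
    have "Re (beam_symbol \<kappa> (q + j) q) = (LINT z|lborel. Re (of_real (std_normal_density z) *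
     ((1 - \<i> * of_real (\<kappa> * z)) ^ (q + j) * (1 + \<i> * of_real (\<kappa> * z)) ^ q)))"
      unfolding beam_symbol_def by (rule integral_Re[symmetric], rule integrable_beam_symbol)
    also have "\<dots> = (LINT z|lborel. std_normal_density z * ((1 + (\<kappa> * z)\<^sup>2) ^ q * poly P z))"
    proof (intro Bochner_Integration.integral_cong refl)
      fix z
      have "(1 - \<i> * of_real (\<kappa> * z)) * (1 + \<i> * of_real (\<kappa> * z)) = of_real (1 + (\<kappa> * z)\<^sup>2)"
        by (simp add: complex_eq_iff power2_eq_square)
      then have "(1 - \<i> * of_real (\<kappa> * z)) ^ (q + j) * (1 + \<i> * of_real (\<kappa> * z)) ^ q =
          of_real ((1 + (\<kappa> * z)\<^sup>2) ^ q) * (1 - \<i> * of_real (\<kappa> * z)) ^ j"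
        unfolding power_add of_real_power by (metis power_mult_distrib mult.commute mult.left_commute)
      then show "Re (of_real (std_normal_density z) *
          ((1 - \<i> * of_real (\<kappa> * z)) ^ (q + j) * (1 + \<i> * of_real (\<kappa> * z)) ^ q)) =
        std_normal_density z * ((1 + (\<kappa> * z)\<^sup>2) ^ q * poly P z)"
        unfolding Re by (simp only: Re_complex_of_real times_complex.sel Im_complex_of_real mult_zero_left diff_zero)
    qed
    finally show ?thesis .
  qed
  consider "lead_coeff P > 0" | "lead_coeff (- P) > 0"
    using \<open>P \<noteq> 0\<close> by (auto simp: not_less) (metis leading_coeff_0_iff linorder_less_linear)
  then show ?thesis
  proof cases
    case 1
    from eventually_gaussian_mean_pos[OF assms 1 even] show ?thesis
      by eventually_elim (metis Re_symbol less_irrefl zero_complex.sel(1))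
  next
    case 2
    have "\<forall>\<^sub>F q in sequentially. (LINT z|lborel. std_normal_density z * ((1 + (\<kappa> * z)\<^sup>2) ^ q * poly (- P) z)) > 0"
      by (rule eventually_gaussian_mean_pos[OF assms 2]) (simp add: even)
    then show ?thesis
    proof eventually_elim
      case (elim q)
      then have "Re (beam_symbol \<kappa> (q + j) q) < 0" unfolding Re_symbol by simp
      then show ?case by auto
    qed
  qed
qed

lemma disk_supported_of_real:
  "disk_supported u \<Longrightarrow> disk_supported (\<lambda>x. complex_of_real (u x))"
  by (auto simp: disk_supported_def intro!: continuous_intros)

section \<open>Vanishing of all polynomial moments\<close>

definition complex_moment :: "(real^2 \<Rightarrow> complex) \<Rightarrow> nat \<Rightarrow> nat \<Rightarrow> complex" where
  "complex_moment u p q = (LINT x|lborel. u x * (plane_complex x ^ p * cnj (plane_complex x) ^ q))"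

lemma integrable_complex_moment:
  assumes "disk_supported u"
  shows "integrable lborel (\<lambda>x. u x * (plane_complex x ^ p * cnj (plane_complex x) ^ q))"
  by (intro disk_supported_integrable_mult assms continuous_intros)

text \<open>In the expansion of degree \<open>n\<close> only frequencies of the same parity as \<open>n\<close> occur, so that after
  multiplication by \<open>cis \<theta> ^ n\<close> it is a polynomial in \<open>(cis \<theta>)\<^sup>2\<close>.\<close>

lemma infinite_squares_of_directions: "infinite ((\<lambda>\<theta>. (cis \<theta>)\<^sup>2) ` {0..<2 * pi})"
proof -
  have "inj_on (\<lambda>\<theta>. (cis \<theta>)\<^sup>2) {0..1}"
  proof (rule inj_onI)
    fix x y :: real
    assume xy: "x \<in> {0..1}" "y \<in> {0..1}" and "(cis x)\<^sup>2 = (cis y)\<^sup>2"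
    then have "cos (2 * x) = cos (2 * y)"
      by (simp add: Complex.DeMoivre complex_eq_iff)
    then show "x = y"
      using cos_inj_pi[of "2 * x" "2 * y"] xy pi_gt3 by auto
  qed
  then have "infinite ((\<lambda>\<theta>. (cis \<theta>)\<^sup>2) ` {0..1})"
    using finite_imageD[of "\<lambda>\<theta>. (cis \<theta>)\<^sup>2" "{0..1}"] infinite_Icc[of "0::real" 1] by linarith
  moreover have "{0..1} \<subseteq> {0..<2 * pi}" using pi_gt3 by auto
  ultimately show ?thesis
    by (meson finite_subset image_mono)
qed

text \<open>The expansion of degree \<open>n = p + q\<close> is a trigonometric polynomial in \<open>\<theta>\<close> that vanishes
  identically, so all its coefficients vanish.\<close>

lemma symbol_times_moment_zero:
  fixes u :: "real^2 \<Rightarrow> real"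
  assumes u: "disk_supported u"
    and zero: "\<And>n \<theta>. \<theta> \<in> {0..<2 * pi} \<Longrightarrow>
      (LINT x|lborel. u x * heat_poly n (dir \<theta> \<bullet> x) ((\<kappa> * (dir_perp \<theta> \<bullet> x))\<^sup>2)) = 0"
  shows "beam_symbol \<kappa> p q * complex_moment (\<lambda>x. of_real (u x)) p q = 0"
proof -
  define n where "n = p + q"
  define c where "c k = of_nat (n choose k) * beam_symbol \<kappa> k (n - k) / 2 ^ n *
      complex_moment (\<lambda>x. of_real (u x)) k (n - k)" for k
  have sum0: "(\<Sum>k\<le>n. c k * (cis (- \<theta>) ^ k * cis \<theta> ^ (n - k))) = 0" if \<theta>: "\<theta> \<in> {0..<2 * pi}" for \<theta>
  proof -
    have "0 = (LINT x|lborel. complex_of_real (u x * heat_poly n (dir \<theta> \<bullet> x) ((\<kappa> * (dir_perp \<theta> \<bullet> x))\<^sup>2)))"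
      using zero[OF \<theta>, of n] by (simp only: integral_complex_of_real of_real_0)
    also have "\<dots> = (LINT x|lborel. (\<Sum>k\<le>n. of_nat (n choose k) * beam_symbol \<kappa> k (n - k) / 2 ^ n *
        (cis (- \<theta>) ^ k * cis \<theta> ^ (n - k)) *
        (of_real (u x) * (plane_complex x ^ k * cnj (plane_complex x) ^ (n - k)))))"
      unfolding of_real_mult heat_poly_angular_expansion
      by (simp only: sum_distrib_left power_mult_distrib times_divide_eq_left times_divide_eq_right mult_ac)
    also have "\<dots> = (\<Sum>k\<le>n. of_nat (n choose k) * beam_symbol \<kappa> k (n - k) / 2 ^ n *
        (cis (- \<theta>) ^ k * cis \<theta> ^ (n - k)) * complex_moment (\<lambda>x. of_real (u x)) k (n - k))"
      unfolding complex_moment_def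
      using integrable_complex_moment[OF disk_supported_of_real[OF u]]
      by (subst Bochner_Integration.integral_sum)
        (intro integrable_mult_right, assumption, simp only: integral_mult_right_zero)
    finally show ?thesis by (simp add: c_def mult_ac)
  qed
  have root: "(\<Sum>k\<le>n. c (n - k) * ((cis \<theta>)\<^sup>2) ^ k) = 0" if \<theta>: "\<theta> \<in> {0..<2 * pi}" for \<theta>
  proof -
    define z where "z = cis \<theta>"
    have inv: "cis (- \<theta>) * z = 1" by (simp add: z_def cis_mult)
    have "(z\<^sup>2) ^ (n - k) = z ^ n * (cis (- \<theta>) ^ k * z ^ (n - k))" if "k \<le> n" for k
    proof -
      have zn: "z ^ n = z ^ k * z ^ (n - k)"
        using that by (simp flip: power_add)
      have "z ^ n * (cis (- \<theta>) ^ k * z ^ (n - k)) = (cis (- \<theta>) * z) ^ k * (z ^ (n - k) * z ^ (n - k))"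
        unfolding zn power_mult_distrib by (simp only: mult_ac)
      then show ?thesis by (simp only: inv power2_eq_square power_mult_distrib power_one mult_1_left)
    qed
    then have "(\<Sum>k\<le>n. c k * (z\<^sup>2) ^ (n - k)) = z ^ n * (\<Sum>k\<le>n. c k * (cis (- \<theta>) ^ k * z ^ (n - k)))"
      unfolding sum_distrib_left by (intro sum.cong refl) (simp only: atMost_iff mult.left_commute)
    also have "\<dots> = 0" using sum0[OF \<theta>] by (simp add: z_def)
    also have "(\<Sum>k\<le>n. c k * (z\<^sup>2) ^ (n - k)) = (\<Sum>k\<le>n. c (n - k) * (z\<^sup>2) ^ k)"
      by (intro sum.reindex_bij_witness[of _ "\<lambda>k. n - k" "\<lambda>k. n - k"]) auto
    finally show ?thesis unfolding z_def .
  qed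
  have "(\<lambda>\<theta>. (cis \<theta>)\<^sup>2) ` {0..<2 * pi} \<subseteq> {x. (\<Sum>k\<le>n. c (n - k) * x ^ k) = 0}"
    using root by blast
  from infinite_super[OF this infinite_squares_of_directions]
  have "infinite {x. (\<Sum>k\<le>n. c (n - k) * x ^ k) = 0}" .
  then have "\<not> (\<exists>k\<le>n. c (n - k) \<noteq> 0)"
    by (simp only: polyfun_finite_roots[of "\<lambda>k. c (n - k)" n] not_False_eq_True)
  then have "c (n - q) = 0" unfolding n_def by (meson le_add2)
  then show ?thesis by (simp add: c_def n_def)
qed

text \<open>Going down from \<open>q0\<close> by one step at a time. With \<open>r = (norm x)\<^sup>2\<close>, the function
  \<open>r ^ m * (1 - (1 - r) ^ N)\<close> is a polynomial in \<open>r\<close> divisible by \<open>r ^ Suc m\<close>, so \<open>v\<close> is orthogonal to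
  it. As \<open>N\<close> grows it tends to \<open>r ^ m\<close> for \<open>0 < r \<le> 1\<close>, that is, at every point of the disk except
  its centre.\<close>

lemma radial_moments_extend:
  fixes v :: "real^2 \<Rightarrow> complex"
  assumes v: "disk_supported v"
    and zero: "\<And>q. q \<ge> q0 \<Longrightarrow> (LINT x|lborel. v x * of_real ((norm x)\<^sup>2 ^ q)) = 0"
  shows "(LINT x|lborel. v x * of_real ((norm x)\<^sup>2 ^ q)) = 0"
  using zero
proof (induction q0)
  case 0
  then show ?case by simp
next
  case (Suc m)
  define r where "r x = (norm x)\<^sup>2" for x :: "real^2"
  have r_cont: "continuous_on S r" for S
    unfolding r_def by (intro continuous_intros)
  have int: "integrable lborel (\<lambda>x. v x * of_real (r x ^ k))" for k
    by (intro disk_supported_integrable_mult v continuous_intros r_cont)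
  have zero': "(LINT x|lborel. v x * of_real (r x ^ k)) = 0" if "k \<ge> Suc m" for k
    using Suc.prems that by (simp add: r_def)
  define g where "g N x = v x * of_real (r x ^ m * (1 - (1 - r x) ^ N))" for N x
  have g_zero: "(LINT x|lborel. g N x) = 0" for N
  proof -
    have "1 - (1 - r x) ^ N = (\<Sum>i<N. r x * (1 - r x) ^ i)" for x
      using one_diff_power_eq[of "1 - r x" N] by (simp add: sum_distrib_left)
    moreover have "(1 - r x) ^ i = (\<Sum>k\<le>i. of_nat (i choose k) * (-1) ^ k * r x ^ k)" for x i
      using binomial_ring[of "- r x" 1 i] by (simp add: power_minus[of "r x"] mult_ac)
    ultimately have "g N x = (\<Sum>i<N. \<Sum>k\<le>i. of_nat (i choose k) * (-1) ^ k * (v x * of_real (r x ^ (Suc m + k))))" for x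
      by (simp add: g_def sum_distrib_left power_add mult_ac)
    then have "(LINT x|lborel. g N x) =
        (\<Sum>i<N. \<Sum>k\<le>i. of_nat (i choose k) * (-1) ^ k * (LINT x|lborel. v x * of_real (r x ^ (Suc m + k))))"
      using int by (simp del: power_Suc of_real_power)
    then show ?thesis using zero' by (simp del: power_Suc of_real_power)
  qed
  have "(LINT x|lborel. v x * of_real (r x ^ m)) = 0"
  proof (rule LIMSEQ_unique)
    show "(\<lambda>N. LINT x|lborel. g N x) \<longlonglongrightarrow> (LINT x|lborel. v x * of_real (r x ^ m))"
    proof (rule integral_dominated_convergence)
      show "(\<lambda>x. v x * of_real (r x ^ m)) \<in> borel_measurable lborel"
        using int[of m] by (rule borel_measurable_integrable)
      show "g N \<in> borel_measurable lborel" for N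
        unfolding g_def
        by (rule borel_measurable_integrable, intro disk_supported_integrable_mult v continuous_intros r_cont)
      show "integrable lborel (\<lambda>x. norm (v x))"
        using disk_supported_integrable[OF v] by (rule integrable_norm)
      have ae: "AE x in lborel. x \<noteq> (0 :: real^2)"
        by (rule AE_lborel_singleton)
      show "AE x in lborel. (\<lambda>N. g N x) \<longlonglongrightarrow> v x * of_real (r x ^ m)"
        using ae
      proof eventually_elim
        case (elim x)
        show ?case
        proof (cases "norm x < 1")
          case True
          have "0 < r x" "r x \<le> 1"
            using elim True by (auto simp: r_def power_le_one)
          then have "(\<lambda>N. (1 - r x) ^ N) \<longlonglongrightarrow> 0"
            by (intro LIMSEQ_realpow_zero) auto
          then have "(\<lambda>N. g N x) \<longlonglongrightarrow> v x * of_real (r x ^ m * (1 - 0))"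
            unfolding g_def by (intro tendsto_mult tendsto_of_real tendsto_diff tendsto_const)
          then show ?thesis by simp
        next
          case False
          then show ?thesis using v by (simp add: g_def disk_supported_def)
        qed
      qed
      show "AE x in lborel. norm (g N x) \<le> norm (v x)" for N
      proof (intro AE_I2)
        fix x
        show "norm (g N x) \<le> norm (v x)"
        proof (cases "norm x < 1")
          case True
          then have r: "0 \<le> r x" "r x \<le> 1"
            by (auto simp: r_def power_le_one)
          then have "0 \<le> (1 - r x) ^ N" "(1 - r x) ^ N \<le> 1"
            by (auto intro!: power_le_one)
          then have "\<bar>r x ^ m * (1 - (1 - r x) ^ N)\<bar> \<le> 1"
            using r by (simp add: abs_mult mult_le_one power_le_one)
          then have "norm (v x) * \<bar>r x ^ m * (1 - (1 - r x) ^ N)\<bar> \<le> norm (v x) * 1"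
            by (rule mult_left_mono) simp
          then show ?thesis
            unfolding g_def norm_mult norm_of_real by simp
        next
          case False
          then show ?thesis using v by (simp add: g_def disk_supported_def)
        qed
      qed
    qed
    show "(\<lambda>N. LINT x|lborel. g N x) \<longlonglongrightarrow> 0"
      using g_zero by simp
  qed
  then have "(LINT x|lborel. v x * of_real (r x ^ k)) = 0" if "k \<ge> m" for k
    using zero'[of k] that by (cases "k = m") auto
  then show ?case using Suc.IH by (simp add: r_def)
qed

text \<open>The diagonals with \<open>p \<ge> q\<close> suffice, because \<open>u\<close> is real and exchanging \<open>p\<close> and \<open>q\<close> conjugates
  the moment.\<close>

lemma complex_moments_zero:
  fixes u :: "real^2 \<Rightarrow> real"
  assumes u: "disk_supported u" and "\<kappa> \<noteq> 0"
    and zero: "\<And>n \<theta>. \<theta> \<in> {0..<2 * pi} \<Longrightarrow>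
      (LINT x|lborel. u x * heat_poly n (dir \<theta> \<bullet> x) ((\<kappa> * (dir_perp \<theta> \<bullet> x))\<^sup>2)) = 0"
  shows "complex_moment (\<lambda>x. of_real (u x)) p q = 0"
proof -
  have upper: "complex_moment (\<lambda>x. of_real (u x)) (q + j) q = 0" for q j
  proof -
    define v where "v x = of_real (u x) * plane_complex x ^ j" for x
    have v: "disk_supported v"
      unfolding v_def by (intro disk_supported_mult disk_supported_of_real u continuous_intros)
    have eq: "complex_moment (\<lambda>x. of_real (u x)) (q + j) q = (LINT x|lborel. v x * of_real ((norm x)\<^sup>2 ^ q))" for q
    proof -
      have "plane_complex x * cnj (plane_complex x) = of_real ((norm x)\<^sup>2)" for x
        by (simp add: plane_complex_def complex_eq_iff norm_vec_def L2_set_def sum_2 power2_eq_square)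
      then have "of_real ((norm x)\<^sup>2 ^ q) = plane_complex x ^ q * cnj (plane_complex x) ^ q" for x
        by (metis of_real_power power_mult_distrib)
      then show ?thesis
        by (simp add: complex_moment_def v_def power_add mult_ac del: of_real_power)
    qed
    obtain q0 where "\<And>q. q \<ge> q0 \<Longrightarrow> beam_symbol \<kappa> (q + j) q \<noteq> 0"
      using beam_symbol_diagonal_nonzero[OF \<open>\<kappa> \<noteq> 0\<close>, of j] by (auto simp: eventually_sequentially)
    then have "complex_moment (\<lambda>x. of_real (u x)) (q + j) q = 0" if "q \<ge> q0" for q
      using symbol_times_moment_zero[OF u zero] that by (metis mult_eq_0_iff)
    then show ?thesis
      unfolding eq by (rule radial_moments_extend[OF v])
  qed
  show ?thesis
  proof (cases "q \<le> p")
    case True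
    then show ?thesis using upper[of q "p - q"] by simp
  next
    case False
    have "complex_moment (\<lambda>x. of_real (u x)) p q = cnj (complex_moment (\<lambda>x. of_real (u x)) q p)"
      unfolding complex_moment_def Bochner_Integration.integral_cnj[symmetric] by (simp add: mult_ac)
    then show ?thesis using False upper[of p "q - p"] by simp
  qed
qed

section \<open>Injectivity of the scalar beam transform\<close>

lemma continuous_on_real_polynomial_function:
  "real_polynomial_function g \<Longrightarrow> continuous_on S g"
  by (simp add: continuous_real_polymonial_function continuous_at_imp_continuous_on)

text \<open>The statement about all \<open>v\<close> with vanishing moments, instead of one fixed function, makes the
  case of products a mere iteration. A linear form is a combination of \<open>plane_complex\<close> and its
  conjugate, so that it only shifts the indices of the moments.\<close>

lemma real_polynomial_mult_preserves_zero_moments: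
  assumes "real_polynomial_function (g :: real^2 \<Rightarrow> real)"
    and "disk_supported v" and "\<And>p q. complex_moment v p q = 0"
  shows "disk_supported (\<lambda>x. v x * of_real (g x)) \<and>
    (\<forall>p q. complex_moment (\<lambda>x. v x * of_real (g x)) p q = 0)"
  using assms
proof (induction g arbitrary: v rule: real_polynomial_function.induct)
  case (linear f)
  define \<alpha> where "\<alpha> = Complex (f (axis 1 1)) (- f (axis 2 1)) / 2"
  have f: "complex_of_real (f x) = \<alpha> * plane_complex x + cnj \<alpha> * cnj (plane_complex x)" for x
  proof -
    have "x = x $ 1 *\<^sub>R axis 1 1 + x $ 2 *\<^sub>R axis 2 1"
      by (simp add: vec_eq_iff axis_def forall_2)
    from arg_cong[OF this, of f] have "f x = x $ 1 * f (axis 1 1) + x $ 2 * f (axis 2 1)"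
      unfolding linear_simps[OF linear.hyps] by simp
    then show ?thesis
      by (simp add: \<alpha>_def plane_complex_def complex_eq_iff field_simps)
  qed
  have "complex_moment (\<lambda>x. v x * of_real (f x)) p q = 0" for p q
  proof -
    have "v x * of_real (f x) * (plane_complex x ^ p * cnj (plane_complex x) ^ q) =
        \<alpha> * (v x * (plane_complex x ^ Suc p * cnj (plane_complex x) ^ q)) +
        cnj \<alpha> * (v x * (plane_complex x ^ p * cnj (plane_complex x) ^ Suc q))" for x
      by (simp add: f algebra_simps)
    then have "complex_moment (\<lambda>x. v x * of_real (f x)) p q =
        (LINT x|lborel. \<alpha> * (v x * (plane_complex x ^ Suc p * cnj (plane_complex x) ^ q)) +
        cnj \<alpha> * (v x * (plane_complex x ^ p * cnj (plane_complex x) ^ Suc q)))"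
      by (simp only: complex_moment_def)
    also have "\<dots> = \<alpha> * complex_moment v (Suc p) q + cnj \<alpha> * complex_moment v p (Suc q)"
      using integrable_complex_moment[OF linear.prems(1)]
      by (simp add: complex_moment_def del: power_Suc)
    finally show ?thesis using linear.prems(2) by simp
  qed
  then show ?case
    using disk_supported_mult[OF linear.prems(1) continuous_on_of_real[OF linear_continuous_on[OF linear.hyps]]]
    by blast
next
  case (const c)
  then show ?case
    using disk_supported_mult[OF const.prems(1) continuous_on_const[of UNIV "complex_of_real c"]]
    by (simp add: complex_moment_def mult.assoc mult.left_commute[of _ "of_real c"])
next
  case (add f g)
  have "complex_moment (\<lambda>x. v x * of_real (f x + g x)) p q =
      complex_moment (\<lambda>x. v x * of_real (f x)) p q + complex_moment (\<lambda>x. v x * of_real (g x)) p q" for p q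
    using integrable_complex_moment add.IH add.prems by (simp add: complex_moment_def ring_distribs)
  moreover have "disk_supported (\<lambda>x. v x * of_real (f x + g x))"
    by (intro disk_supported_mult add.prems continuous_intros
        continuous_on_real_polynomial_function add.hyps)
  ultimately show ?case
    using add.IH add.prems by simp
next
  case (mult f g)
  have "disk_supported (\<lambda>x. v x * of_real (f x) * of_real (g x)) \<and>
      (\<forall>p q. complex_moment (\<lambda>x. v x * of_real (f x) * of_real (g x)) p q = 0)"
    using mult.IH(1)[OF mult.prems] by (intro mult.IH(2)) auto
  then show ?case by (simp add: mult.assoc)
qed

text \<open>If \<open>g\<close> is a polynomial within \<open>e\<close> of \<open>u\<close> on the disk, then the integral of \<open>u\<^sup>2\<close> equals that of
  \<open>u * (u - g)\<close> and is at most \<open>e\<close> times the integral of \<open>\<bar>u\<bar>\<close>.\<close>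

lemma zero_if_complex_moments_zero:
  fixes u :: "real^2 \<Rightarrow> real"
  assumes u: "disk_supported u" and zero: "\<And>p q. complex_moment (\<lambda>x. of_real (u x)) p q = 0"
  shows "u x = 0"
proof -
  have cont: "continuous_on UNIV u" using u by (rule disk_supported_continuous)
  have int: "integrable lborel u" using u by (rule disk_supported_integrable)
  define J where "J = (LINT x|lborel. (u x)\<^sup>2)"
  have int2: "integrable lborel (\<lambda>x. (u x)\<^sup>2)"
    unfolding power2_eq_square by (intro disk_supported_integrable_mult u cont)
  have "J \<le> e * (LINT x|lborel. \<bar>u x\<bar>)" if "e > 0" for e
  proof -
    obtain g where g: "real_polynomial_function g" "\<And>x. x \<in> cball 0 1 \<Longrightarrow> \<bar>u x - g x\<bar> < e"
      using Stone_Weierstrass_real_polynomial_function[of "cball 0 1" u e] \<open>e > 0\<close> cont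
      by (auto intro: continuous_on_subset)
    have int_g: "integrable lborel (\<lambda>x. u x * g x)"
      by (intro disk_supported_integrable_mult u continuous_on_real_polynomial_function g)
    have "complex_moment (\<lambda>x. of_real (u x) * of_real (g x)) 0 0 = 0"
      using real_polynomial_mult_preserves_zero_moments[OF g(1) disk_supported_of_real[OF u] zero] by blast
    then have "(LINT x|lborel. u x * g x) = 0"
      by (simp add: complex_moment_def flip: of_real_mult)
    then have "J = (LINT x|lborel. (u x)\<^sup>2 - u x * g x)"
      using int2 int_g by (simp add: J_def)
    also have "\<dots> \<le> (LINT x|lborel. e * \<bar>u x\<bar>)"
    proof (rule integral_mono)
      fix x
      have "\<bar>u x\<bar> * \<bar>u x - g x\<bar> \<le> \<bar>u x\<bar> * e"
      proof (cases "norm x \<le> 1")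
        case True
        then show ?thesis using g(2)[of x] by (intro mult_left_mono) auto
      next
        case False
        then show ?thesis using u by (simp add: disk_supported_def)
      qed
      moreover have "(u x)\<^sup>2 - u x * g x \<le> \<bar>u x\<bar> * \<bar>u x - g x\<bar>"
        unfolding abs_mult[symmetric] power2_eq_square right_diff_distrib[symmetric]
        by (rule abs_ge_self)
      ultimately show "(u x)\<^sup>2 - u x * g x \<le> e * \<bar>u x\<bar>" by (simp add: mult.commute)
    qed (use int int2 int_g in auto)
    finally show ?thesis by simp
  qed
  note J_le = this
  have "J \<le> 0"
  proof (rule field_le_epsilon)
    fix e :: real assume "e > 0"
    define c where "c = (LINT x|lborel. \<bar>u x\<bar>)"
    have "c \<ge> 0" by (simp add: c_def)
    then have pos: "e / (c + 1) > 0" using \<open>e > 0\<close> by simp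
    have "J \<le> e / (c + 1) * c"
      unfolding c_def by (rule J_le) (use pos in \<open>simp only: c_def\<close>)
    also have "\<dots> \<le> e / (c + 1) * (c + 1)"
      using pos by (intro mult_left_mono) auto
    also have "\<dots> = e"
      using \<open>c \<ge> 0\<close> by simp
    finally show "J \<le> 0 + e" by simp
  qed
  moreover have "J \<ge> 0" by (simp add: J_def)
  ultimately have "J = 0" by simp
  then have "AE x in lborel. (u x)\<^sup>2 = 0"
    using integral_nonneg_eq_0_iff_AE[OF int2] by (simp add: J_def)
  then have "AE x in lborel. x \<notin> {x. u x \<noteq> 0}" by simp
  moreover have "open {x. u x \<noteq> 0}"
    by (rule open_Collect_neq[OF cont continuous_on_const])
  ultimately have "{x. u x \<noteq> 0} \<in> null_sets lborel"
    using AE_iff_null_sets[of "{x. u x \<noteq> 0}" lborel] by (simp only: sets_lborel borel_open)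
  then have "negligible {x. u x \<noteq> 0}"
    unfolding negligible_iff_null_sets by (rule null_sets_completionI)
  then show ?thesis
    using open_not_negligible[OF \<open>open {x. u x \<noteq> 0}\<close>] by blast
qed

definition beam_transform :: "real \<Rightarrow> real \<Rightarrow> (real^2 \<Rightarrow> real) \<Rightarrow> real \<Rightarrow> real \<Rightarrow> real" where
  "beam_transform w0 lam u s \<theta> =
     (LINT x|lborel. beam_kernel w0 lam (s - dir \<theta> \<bullet> x) (dir_perp \<theta> \<bullet> x) * u x)"

theorem beam_transform_injective:
  fixes u :: "real^2 \<Rightarrow> real"
  assumes "w0 > 0" "lam > 0" and u: "disk_supported u"
    and zero: "\<And>s \<theta>. \<theta> \<in> {0..<2 * pi} \<Longrightarrow> beam_transform w0 lam u s \<theta> = 0"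
  shows "u x = 0"
proof -
  define \<kappa> where "\<kappa> = w0 / (sqrt 2 * rayleigh_range w0 lam)"
  have "\<kappa> \<noteq> 0"
    using assms by (simp add: \<kappa>_def rayleigh_range_def)
  have moments: "(LINT x|lborel. u x * heat_poly n (dir \<theta> \<bullet> x) ((\<kappa> * (dir_perp \<theta> \<bullet> x))\<^sup>2)) = 0"
    if "\<theta> \<in> {0..<2 * pi}" for n \<theta>
  proof (rule heat_flow_cancel[where A = "w0\<^sup>2 / 2"])
    fix m
    show "(LINT x|lborel. u x * heat_poly m (dir \<theta> \<bullet> x) (w0\<^sup>2 / 2 + (\<kappa> * (dir_perp \<theta> \<bullet> x))\<^sup>2)) = 0"
    proof (rule normal_mixture_moments)
      fix s
      have "0 = (LINT x|lborel. w0 * sqrt pi * (normal_density (dir \<theta> \<bullet> x)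
          (sqrt (w0\<^sup>2 / 2 + (\<kappa> * (dir_perp \<theta> \<bullet> x))\<^sup>2)) s * u x))"
        using zero[OF that, of s]
        by (simp only: beam_transform_def beam_kernel_eq_normal_density[OF assms(1,2)] \<kappa>_def mult.assoc)
      then show "(LINT x|lborel. normal_density (dir \<theta> \<bullet> x)
          (sqrt (w0\<^sup>2 / 2 + (\<kappa> * (dir_perp \<theta> \<bullet> x))\<^sup>2)) s * u x) = 0"
        using \<open>w0 > 0\<close> by simp
    qed (use \<open>w0 > 0\<close> in \<open>auto intro!: continuous_intros u add_pos_nonneg\<close>)
  qed (auto intro!: continuous_intros u)
  show ?thesis
    by (rule zero_if_complex_moments_zero[OF u complex_moments_zero[OF u \<open>\<kappa> \<noteq> 0\<close> moments]])
qed

section \<open>Recovering the tensor field\<close>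

lemma continuous_on_beam_kernel:
  assumes "w0 > 0" "lam > 0"
  shows "continuous_on UNIV (\<lambda>x. beam_kernel w0 lam (s - dir \<theta> \<bullet> x) (dir_perp \<theta> \<bullet> x))"
proof -
  have "1 + (t / rayleigh_range w0 lam)\<^sup>2 \<noteq> 0" for t
    by (metis add_pos_nonneg less_irrefl zero_le_power2 zero_less_one)
  then show ?thesis
    unfolding beam_kernel_def beam_width_def
    using assms by (intro continuous_intros) (auto simp: rayleigh_range_def)
qed

lemma test_function_disk_supported:
  assumes "g \<in> test_functions (ball 0 1)"
  shows "disk_supported g"
proof -
  have "continuous_on (ball 0 1) g" "continuous_on (- closure {x. g x \<noteq> 0}) g"
    and sub: "closure {x. g x \<noteq> 0} \<subseteq> ball 0 1"
  proof -
    have "times_cont_diff_on 0 (ball 0 1) g"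
      using assms unfolding test_functions_def smooth_on_def by blast
    then show "continuous_on (ball 0 1) g" by simp
    have "g x = 0" if "x \<in> - closure {x. g x \<noteq> 0}" for x
      using that closure_subset[of "{x. g x \<noteq> 0}"] by auto
    then show "continuous_on (- closure {x. g x \<noteq> 0}) g"
      by (rule continuous_on_cong[THEN iffD2, OF refl]) (auto intro: continuous_on_const)
    show "closure {x. g x \<noteq> 0} \<subseteq> ball 0 1"
      using assms by (simp add: test_functions_def)
  qed
  then have "continuous_on (ball 0 1 \<union> - closure {x. g x \<noteq> 0}) g"
    by (intro continuous_on_open_Un) auto
  moreover have "ball 0 1 \<union> - closure {x. g x \<noteq> 0} = UNIV"
    using sub by blast
  moreover have "g x = 0" if "norm x \<ge> 1" for x
    using that sub closure_subset[of "{x. g x \<noteq> 0}"] by force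
  ultimately show ?thesis by (simp add: disk_supported_def)
qed

theorem theorem3:
  fixes w0 lam :: real and f h :: "real^2 \<Rightarrow> real^2^2"
  assumes "w0 > 0" and "lam > 0"
    and "f \<in> symmetric_tensor_fields (ball 0 1)"
    and "h \<in> symmetric_tensor_fields (ball 0 1)"
    and "\<And>s \<theta>. \<theta> \<in> {0..<2 * pi} \<Longrightarrow>
      longitudinal_transform w0 lam f s \<theta> = longitudinal_transform w0 lam h s \<theta>"
    and "\<And>s \<theta>. \<theta> \<in> {0..<2 * pi} \<Longrightarrow>
      transverse_transform w0 lam f s \<theta> = transverse_transform w0 lam h s \<theta>"
    and "\<And>s \<theta>. \<theta> \<in> {0..<2 * pi} \<Longrightarrow>
      mixed_transform w0 lam f s \<theta> = mixed_transform w0 lam h s \<theta>"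
  shows "f = h"
proof -
  define B where "B g i j s \<theta> = beam_transform w0 lam (\<lambda>x. g x $ i $ j) s \<theta>" for g :: "real^2 \<Rightarrow> real^2^2" and i j s \<theta>
  have supp: "disk_supported (\<lambda>x. g x $ i $ j)" if "g \<in> symmetric_tensor_fields (ball 0 1)" for g i j
    using that by (simp add: symmetric_tensor_fields_def test_function_disk_supported)
  have int: "integrable lborel (\<lambda>x. beam_kernel w0 lam (s - dir \<theta> \<bullet> x) (dir_perp \<theta> \<bullet> x) * g x $ i $ j)"
    if "g \<in> symmetric_tensor_fields (ball 0 1)" for g i j s \<theta>
    using disk_supported_integrable_mult[OF supp[OF that] continuous_on_beam_kernel[OF assms(1,2)]]
    by (simp add: mult.commute)
  \<comment> \<open>By symmetry of the tensor, contraction with two directions involves three scalar transforms only.\<close>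
  have contract: "(LINT x|lborel. beam_kernel w0 lam (s - dir \<theta> \<bullet> x) (dir_perp \<theta> \<bullet> x) *
        (\<Sum>i\<in>UNIV. \<Sum>j\<in>UNIV. a $ i * b $ j * g x $ i $ j)) =
      a $ 1 * b $ 1 * B g 1 1 s \<theta> + (a $ 1 * b $ 2 + a $ 2 * b $ 1) * B g 1 2 s \<theta> + a $ 2 * b $ 2 * B g 2 2 s \<theta>"
    if g: "g \<in> symmetric_tensor_fields (ball 0 1)" for g s \<theta> and a b :: "real^2"
  proof -
    define K where "K x = beam_kernel w0 lam (s - dir \<theta> \<bullet> x) (dir_perp \<theta> \<bullet> x)" for x
    have sym: "g x $ 2 $ 1 = g x $ 1 $ 2" for x
      using g by (simp add: symmetric_tensor_fields_def)
    have "(LINT x|lborel. K x * (\<Sum>i\<in>UNIV. \<Sum>j\<in>UNIV. a $ i * b $ j * g x $ i $ j)) =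
        (LINT x|lborel. a $ 1 * b $ 1 * (K x * g x $ 1 $ 1) +
          (a $ 1 * b $ 2 + a $ 2 * b $ 1) * (K x * g x $ 1 $ 2) + a $ 2 * b $ 2 * (K x * g x $ 2 $ 2))"
      by (intro Bochner_Integration.integral_cong refl) (simp add: sum_2 sym algebra_simps)
    also have "\<dots> = a $ 1 * b $ 1 * B g 1 1 s \<theta> + (a $ 1 * b $ 2 + a $ 2 * b $ 1) * B g 1 2 s \<theta>
        + a $ 2 * b $ 2 * B g 2 2 s \<theta>"
      using int[OF g, of s \<theta>] by (simp add: B_def beam_transform_def K_def)
    finally show ?thesis by (simp add: K_def)
  qed
  have B_eq: "B f 1 1 s \<theta> = B h 1 1 s \<theta> \<and> B f 1 2 s \<theta> = B h 1 2 s \<theta> \<and> B f 2 2 s \<theta> = B h 2 2 s \<theta>"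
    if \<theta>: "\<theta> \<in> {0..<2 * pi}" for s \<theta>
  proof -
    define c n where "c = cos \<theta>" and "n = sin \<theta>"
    define X Y Z where "X = B f 1 1 s \<theta> - B h 1 1 s \<theta>" and "Y = B f 1 2 s \<theta> - B h 1 2 s \<theta>"
      and "Z = B f 2 2 s \<theta> - B h 2 2 s \<theta>"
    have dirs: "dir \<theta> $ 1 = c" "dir \<theta> $ 2 = n" "dir_perp \<theta> $ 1 = - n" "dir_perp \<theta> $ 2 = c"
      by (simp_all add: dir_def dir_perp_def c_def n_def)
    note contr = contract[OF assms(3), of s \<theta>] contract[OF assms(4), of s \<theta>]
    have L: "n * n * X - 2 * n * c * Y + c * c * Z = 0"
      using assms(5)[OF \<theta>, of s] unfolding longitudinal_transform_def contr dirs
      by (simp add: X_def Y_def Z_def algebra_simps)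
    have T: "c * c * X + 2 * n * c * Y + n * n * Z = 0"
      using assms(6)[OF \<theta>, of s] unfolding transverse_transform_def contr dirs
      by (simp add: X_def Y_def Z_def algebra_simps)
    have M: "- n * c * X + (c * c - n * n) * Y + n * c * Z = 0"
      using assms(7)[OF \<theta>, of s] unfolding mixed_transform_def contr dirs
      by (simp add: X_def Y_def Z_def algebra_simps)
    have cn: "c * c + n * n = 1"
      using sin_cos_squared_add2[of \<theta>] by (simp add: c_def n_def power2_eq_square)
    \<comment> \<open>Inverting the rotation: for instance \<open>X\<close> is \<open>n * n\<close> times \<open>L\<close> plus \<open>c * c\<close> times \<open>T\<close> minus \<open>2 * n * c\<close> times \<open>M\<close>.\<close>
    have "X = 0" using L T M cn by algebra
    moreover have "Y = 0" using L T M cn by algebra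
    moreover have "Z = 0" using L T M cn by algebra
    ultimately show ?thesis by (simp add: X_def Y_def Z_def)
  qed
  have entry: "f x $ i $ j = h x $ i $ j"
    if eq: "\<And>s \<theta>. \<theta> \<in> {0..<2 * pi} \<Longrightarrow> B f i j s \<theta> = B h i j s \<theta>" for i j x
  proof -
    have "f x $ i $ j - h x $ i $ j = 0"
    proof (rule beam_transform_injective[OF assms(1,2), of "\<lambda>x. f x $ i $ j - h x $ i $ j"])
      show "disk_supported (\<lambda>x. f x $ i $ j - h x $ i $ j)"
        using supp[OF assms(3)] supp[OF assms(4)] by (auto simp: disk_supported_def intro!: continuous_on_diff)
      fix s \<theta> :: real
      assume "\<theta> \<in> {0..<2 * pi}"
      with eq show "beam_transform w0 lam (\<lambda>x. f x $ i $ j - h x $ i $ j) s \<theta> = 0"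
        using int[OF assms(3), of s \<theta> i j] int[OF assms(4), of s \<theta> i j]
        by (simp add: B_def beam_transform_def right_diff_distrib)
    qed
    then show ?thesis by simp
  qed
  have "f x $ i $ j = f x $ j $ i" "h x $ i $ j = h x $ j $ i" for x i j
    using assms(3,4) by (simp_all add: symmetric_tensor_fields_def)
  moreover have "f x $ 1 $ 1 = h x $ 1 $ 1" "f x $ 1 $ 2 = h x $ 1 $ 2" "f x $ 2 $ 2 = h x $ 2 $ 2" for x
    by (rule entry, simp add: B_eq)+
  ultimately show ?thesis
    by (auto simp: fun_eq_iff vec_eq_iff forall_2)
qed

end
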